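(* Let $\varepsilon \in (0,1)$ and $[a,b] \subset (0,1)$. For $p \in (0,1)$, let $X_1, X_2, \ldots$ be i.i.d. Bernoulli random variables on a probability space $(\Omega, \mathscr{F}, \Pr)$ with $\Pr\{X_i = 1\} = p$ and $\Pr\{X_i = 0\} = 1-p$ for every positive integer $i$. Let $\gamma$ be a positive integer, let $\boldsymbol{n}(\omega) = \min\{ n \in \mathbb{Z} : \sum_{i=1}^n X_i(\omega) = \gamma \}$, and define $\widetilde{\boldsymbol{p}} = \frac{\gamma}{\boldsymbol{n}}$ and, when $\gamma \ge 2$, $\widehat{\boldsymbol{p}} = \frac{\gamma-1}{\boldsymbol{n}-1}$. Then, for $\gamma \ge 2$, the minimum of $\Pr\left\{ \left| \frac{\widehat{\boldsymbol{p}} - p}{p} \right| < \varepsilon \right\}$ with respect to $p \in [a,b]$ is achieved on the set $$\{a,b\} \cup \left\{ \frac{\gamma-1}{(1-\varepsilon)(\ell+\gamma-1)} \in (a,b) : \ell = 0,1,2,\ldots \right\} \cup \left\{ \frac{\gamma-1}{(1+\varepsilon)(\ell+\gamma-1)} \in (a,b) : \ell = 0,1,2,\ldots \right\}.$$ Similarly, for $\gamma\ge 1$, the minimum of $\Pr\left\{ \left| \frac{\widetilde{\boldsymbol{p}} - p}{p} \right| < \varepsilon \right\}$ with respect to $p \in [a,b]$ is achieved on the set $$\{a,b\} \cup \left\{ \frac{\gamma}{(1-\varepsilon)(\ell+\gamma)} \in (a,b) : \ell = 0,1,2,\ldots \right\} \cup \left\{ \frac{\gamma}{(1+\varepsilon)(\ell+\gamma)}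 \in (a,b) : \ell = 0,1,2,\ldots \right\}.$$
   Context: The probabilities are regarded as functions of the Bernoulli parameter $p$, with $\varepsilon$ and $\gamma$ fixed. "Achieved on the set" means that the minimum over $p\in[a,b]$ exists and is attained at some point of the given set. *)

theory Defs
  imports "HOL-Probability.Probability"
begin

text \<open>
  Only the variables with positive index matter. They are real-valued, so other values than
  0 and 1 are possible, but only with probability 0.
\<close>
definition iid_bernoulli :: "'a measure \<Rightarrow> (nat \<Rightarrow> 'a \<Rightarrow> real) \<Rightarrow> real \<Rightarrow> bool" where
  "iid_bernoulli M X p \<longleftrightarrow>
     prob_space M \<and>
     prob_space.indep_vars M (\<lambda>_. borel) X {1..} \<and>
     (\<forall>i\<ge>1. \<P>(\<omega> in M. X i \<omega> = 1) = p \<and> \<P>(\<omega> in M. X i \<omega> = 0) = 1 - p)"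

text \<open>
  For \<open>\<gamma> \<ge> 1\<close> sums with nonpositive upper limit are empty and differ from \<open>\<gamma>\<close>, so the minimum
  may be taken over the natural numbers. For i.i.d. Bernoulli variables with \<open>p > 0\<close> the sum
  reaches \<open>\<gamma>\<close> almost surely; elsewhere the value is an unspecified constant.
\<close>
definition stopping_index :: "nat \<Rightarrow> (nat \<Rightarrow> 'a \<Rightarrow> real) \<Rightarrow> 'a \<Rightarrow> nat" where
  "stopping_index \<gamma> X \<omega> = (LEAST n. (\<Sum>i=1..n. X i \<omega>) = real \<gamma>)"

definition p_tilde :: "nat \<Rightarrow> (nat \<Rightarrow> 'a \<Rightarrow> real) \<Rightarrow> 'a \<Rightarrow> real" where
  "p_tilde \<gamma> X \<omega> = real \<gamma> / real (stopping_index \<gamma> X \<omega>)"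

definition p_hat :: "nat \<Rightarrow> (nat \<Rightarrow> 'a \<Rightarrow> real) \<Rightarrow> 'a \<Rightarrow> real" where
  "p_hat \<gamma> X \<omega> = (real \<gamma> - 1) / (real (stopping_index \<gamma> X \<omega>) - 1)"

end

theory Submission
  imports Defs "HOL-Real_Asymp.Real_Asymp"
begin

text \<open>
  With \<open>g = \<gamma>\<close> or \<open>g = \<gamma> - 1\<close>, both estimators equal \<open>g / (l + g)\<close> where \<open>l\<close> is the number of failures
  before the \<open>\<gamma>\<close>-th success, so the coverage probability at \<open>p\<close> is the sum of the negative binomial
  weights over an interval of values \<open>l\<close> that changes only at the breakpoints \<open>g / ((1 \<plusminus> \<epsilon>) (l + g))\<close>.
  For a fixed interval the derivative in \<open>p\<close> telescopes to a difference of two terms and changes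
  sign at most once, from positive to negative; hence between consecutive breakpoints the coverage
  is at least the smaller of its one-sided limits there. Because the error bound is strict, the value
  at a breakpoint does not exceed these limits.
\<close>

subsection \<open>Negative binomial weights\<close>

text \<open>For \<open>\<gamma> \<ge> 1\<close> this is the negative binomial mass function: exactly
  \<open>l\<close> failures before the success numbered \<open>\<gamma>\<close>.\<close>

definition nb_weight :: "nat \<Rightarrow> nat \<Rightarrow> real \<Rightarrow> real" where
  "nb_weight \<gamma> l p = real ((l + \<gamma> - 1) choose l) * p ^ \<gamma> * (1 - p) ^ l"

lemma nb_weight_nonneg: "0 \<le> p \<Longrightarrow> p \<le> 1 \<Longrightarrow> 0 \<le> nb_weight \<gamma> l p"
  by (simp add: nb_weight_def)

text \<open>The derivatives of the weights telescope. At \<open>k = 0\<close> the factor \<open>k\<close> makes the truncated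
  exponent harmless.\<close>
definition nb_slope :: "nat \<Rightarrow> nat \<Rightarrow> real \<Rightarrow> real" where
  "nb_slope \<gamma> k p = real k * real ((k + \<gamma> - 1) choose k) * p ^ (\<gamma> - 1) * (1 - p) ^ (k - 1)"

text \<open>One factor \<open>p\<close> in the second term of the product rule is rewritten as
  \<open>1 - (1 - p)\<close>. The coefficient of \<open>(1 - p) ^ l\<close> then becomes
  \<open>l + \<gamma>\<close> times the binomial coefficient, and the absorption identity
  \<open>rec\<close> turns this into the slope at \<open>Suc l\<close>.\<close>

lemma DERIV_nb_weight:
  assumes "\<gamma> \<ge> 1"
  shows "(nb_weight \<gamma> l has_real_derivative nb_slope \<gamma> (Suc l) p - nb_slope \<gamma> l p) (at p)"
proof -
  obtain g where g: "\<gamma> = Suc g" using assms by (cases \<gamma>) auto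
  let ?c = "real ((l + g) choose l)"
  have rec: "real (Suc l) * real (Suc (l + g) choose Suc l) = real (Suc (l + g)) * ?c"
    by (metis Suc_times_binomial_eq mult.commute of_nat_mult)
  have "(nb_weight \<gamma> l has_real_derivative
      ?c * (real (Suc g) * p ^ g * (1 - p) ^ l - p ^ Suc g * (real l * (1 - p) ^ (l - 1)))) (at p)"
    unfolding nb_weight_def g
    by (rule derivative_eq_intros refl)+ (simp add: algebra_simps)
  also have "?c * (real (Suc g) * p ^ g * (1 - p) ^ l - p ^ Suc g * (real l * (1 - p) ^ (l - 1)))
      = nb_slope \<gamma> (Suc l) p - nb_slope \<gamma> l p"
  proof -
    have "nb_slope \<gamma> (Suc l) p = real (Suc (l + g)) * ?c * p ^ g * (1 - p) ^ l"
      using rec by (simp add: nb_slope_def g)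
    moreover have "nb_slope \<gamma> l p = real l * ?c * p ^ g * (1 - p) ^ (l - 1)"
      by (simp add: nb_slope_def g)
    ultimately show ?thesis
      by (cases l) (simp_all add: algebra_simps)
  qed
  finally show ?thesis .
qed

lemma DERIV_sum_nb_weight:
  assumes "\<gamma> \<ge> 1" "m \<le> n"
  shows "((\<lambda>p. \<Sum>l=m..<n. nb_weight \<gamma> l p) has_real_derivative nb_slope \<gamma> n p - nb_slope \<gamma> m p) (at p)"
  using assms(2)
proof (induction n rule: dec_induct)
  case base
  then show ?case by simp
next
  case (step n)
  from DERIV_add[OF step.IH DERIV_nb_weight[OF assms(1), of n p]] step.hyps
  show ?case by simp
qed

text \<open>The slope changes sign at most once, from positive to negative, so the sum
  is quasiconcave.\<close>
lemma sum_nb_weight_ge_min: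
  assumes "\<gamma> \<ge> 1" "0 < u" "u \<le> x" "x \<le> v" "v < 1"
  shows "min (\<Sum>l=m..<n. nb_weight \<gamma> l u) (\<Sum>l=m..<n. nb_weight \<gamma> l v) \<le> (\<Sum>l=m..<n. nb_weight \<gamma> l x)"
proof (cases "m < n")
  case False
  then show ?thesis by simp
next
  case True
  \<comment> \<open>For \<open>m > 0\<close>, \<open>h\<close> is what remains of the slope
    difference after the nonnegative factor \<open>y ^ (\<gamma> - 1) * (1 - y) ^ (m - 1)\<close> is
    taken out. It is antitone up to 1, which gives the single sign change.\<close>
  define h where "h y = real n * real ((n + \<gamma> - 1) choose n) * (1 - y) ^ (n - m)
      - real m * real ((m + \<gamma> - 1) choose m)" for y :: real
  have slope: "nb_slope \<gamma> n y - nb_slope \<gamma> m y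
      = (if m = 0 then nb_slope \<gamma> n y else y ^ (\<gamma> - 1) * (1 - y) ^ (m - 1) * h y)" for y
  proof (cases m)
    case 0
    then show ?thesis by (simp add: nb_slope_def)
  next
    case (Suc k)
    have "(1 - y) ^ (n - 1) = (1 - y) ^ (n - m) * (1 - y) ^ (m - 1)"
      using Suc True by (simp flip: power_add)
    then show ?thesis using Suc by (simp add: nb_slope_def h_def algebra_simps)
  qed
  have anti: "h z \<le> h y" if "y \<le> z" "z \<le> 1" for y z
    unfolding h_def using that by (intro diff_mono mult_left_mono power_mono) auto
  have deriv: "((\<lambda>p. \<Sum>l=m..<n. nb_weight \<gamma> l p) has_real_derivative nb_slope \<gamma> n y - nb_slope \<gamma> m y) (at y)"
    for y using DERIV_sum_nb_weight[OF assms(1)] True by simp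
  \<comment> \<open>The sign at \<open>x\<close> decides the side: if \<open>h x\<close> is
    nonnegative, the sum increases on \<open>[u, x]\<close>; if it is negative, the sum decreases on
    \<open>[x, v]\<close>. For \<open>m = 0\<close> the subtracted slope vanishes and the sum
    increases.\<close>
  show ?thesis
  proof (cases "m = 0 \<or> h x \<ge> 0")
    case up: True
    have "nb_slope \<gamma> n y - nb_slope \<gamma> m y \<ge> 0" if "u \<le> y" "y \<le> x" for y
    proof (cases "m = 0")
      case True
      then show ?thesis using that assms by (simp add: nb_slope_def)
    next
      case False
      then have "h y \<ge> 0" using up anti[of y x] that assms by simp
      then show ?thesis using that assms False by (simp add: slope)
    qed
    with deriv have "(\<Sum>l=m..<n. nb_weight \<gamma> l u) \<le> (\<Sum>l=m..<n. nb_weight \<gamma> l x)"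
      by (rule DERIV_nonneg_imp_nondecreasing[OF assms(3), OF exI, OF conjI])
    then show ?thesis by simp
  next
    case down: False
    have "nb_slope \<gamma> n y - nb_slope \<gamma> m y \<le> 0" if "x \<le> y" "y \<le> v" for y
    proof -
      have "h y \<le> 0" using down anti[of x y] that assms by simp
      then show ?thesis using that assms down by (simp add: slope mult_nonneg_nonpos)
    qed
    with deriv have "(\<Sum>l=m..<n. nb_weight \<gamma> l v) \<le> (\<Sum>l=m..<n. nb_weight \<gamma> l x)"
      by (rule DERIV_nonpos_imp_nonincreasing[OF assms(4), OF exI, OF conjI])
    then show ?thesis by simp
  qed
qed

subsection \<open>Breakpoints\<close>

text \<open>With denominators cleared, both conditions are linear in \<open>p\<close> and in
  \<open>l\<close>. The real parameter \<open>g\<close> stands for \<open>\<gamma>\<close> or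
  \<open>\<gamma> - 1\<close>.\<close>

definition hit_set :: "real \<Rightarrow> real \<Rightarrow> real \<Rightarrow> nat set" where
  "hit_set g \<epsilon> p = {l. (1 - \<epsilon>) * p * (real l + g) < g \<and> g < (1 + \<epsilon>) * p * (real l + g)}"

lemma hit_set_iff:
  assumes "0 < p" "0 < g"
  shows "l \<in> hit_set g \<epsilon> p \<longleftrightarrow> \<bar>(g / (real l + g) - p) / p\<bar> < \<epsilon>"
proof -
  have pos: "p * (real l + g) > 0" using assms by simp
  have "\<bar>(g / (real l + g) - p) / p\<bar> < \<epsilon> \<longleftrightarrow> 1 - \<epsilon> < g / (p * (real l + g)) \<and> g / (p * (real l + g)) < 1 + \<epsilon>"
  proof -
    have "(g / (real l + g) - p) / p = g / (p * (real l + g)) - 1"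
      using assms by (simp add: diff_divide_distrib mult.commute)
    then show ?thesis by (auto simp: abs_less_iff)
  qed
  then show ?thesis
    using pos by (simp add: hit_set_def pos_less_divide_eq pos_divide_less_eq mult.assoc)
qed

text \<open>Too many failures violate the condition with factor \<open>1 - \<epsilon>\<close>, which
  is positive.\<close>

lemma finite_hit_set:
  assumes "0 < p" "\<epsilon> < 1"
  shows "finite (hit_set g \<epsilon> p)"
proof (rule finite_subset)
  show "hit_set g \<epsilon> p \<subseteq> {l. real l \<le> g / ((1 - \<epsilon>) * p) - g}"
  proof safe
    fix l assume "l \<in> hit_set g \<epsilon> p"
    then have "(real l + g) * ((1 - \<epsilon>) * p) < g" by (simp add: hit_set_def mult.commute)
    then have "real l + g < g / ((1 - \<epsilon>) * p)" using assms by (simp add: pos_less_divide_eq)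
    then show "real l \<le> g / ((1 - \<epsilon>) * p) - g" by simp
  qed
  show "finite {l. real l \<le> g / ((1 - \<epsilon>) * p) - g}"
    by (rule finite_nat_set_iff_bounded_le[THEN iffD2]) (metis mem_Collect_eq le_nat_floor)
qed

lemma convex_finite_nat_set:
  fixes A :: "nat set"
  assumes "finite A" "\<And>i j k. i \<in> A \<Longrightarrow> k \<in> A \<Longrightarrow> i \<le> j \<Longrightarrow> j \<le> k \<Longrightarrow> j \<in> A"
  obtains m n where "A = {m..<n}"
proof (cases "A = {}")
  case True
  then show ?thesis using that[of 0 0] by simp
next
  case False
  have "A = {Min A..<Suc (Max A)}"
  proof
    show "A \<subseteq> {Min A..<Suc (Max A)}" using assms(1) by (auto simp: less_Suc_eq_le)
    show "{Min A..<Suc (Max A)} \<subseteq> A"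
    proof
      fix j assume "j \<in> {Min A..<Suc (Max A)}"
      then have "Min A \<le> j" "j \<le> Max A" by auto
      then show "j \<in> A" by (rule assms(2)[OF Min_in[OF assms(1) False] Max_in[OF assms(1) False]])
    qed
  qed
  then show ?thesis by (rule that)
qed

text \<open>The first condition passes to smaller \<open>l\<close> and the second to larger
  \<open>l\<close>. The contiguous range is the form that \<open>sum_nb_weight_ge_min\<close> works
  with.\<close>

lemma hit_set_interval:
  assumes "0 < p" "\<epsilon> < 1" "0 < \<epsilon>"
  obtains m n where "hit_set g \<epsilon> p = {m..<n}"
proof (rule convex_finite_nat_set[OF finite_hit_set[OF assms(1,2)]])
  fix i j k
  assume "i \<in> hit_set g \<epsilon> p" "k \<in> hit_set g \<epsilon> p" "i \<le> j" "j \<le> k"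
  moreover have "(1 + \<epsilon>) * p * (real i + g) \<le> (1 + \<epsilon>) * p * (real j + g)"
    "(1 - \<epsilon>) * p * (real j + g) \<le> (1 - \<epsilon>) * p * (real k + g)"
    using \<open>i \<le> j\<close> \<open>j \<le> k\<close> assms by (auto intro!: mult_left_mono)
  ultimately show "j \<in> hit_set g \<epsilon> p" by (auto simp: hit_set_def)
qed (rule that)

definition breakpoints :: "real \<Rightarrow> real \<Rightarrow> real set" where
  "breakpoints g \<epsilon> = (\<Union>c\<in>{1 - \<epsilon>, 1 + \<epsilon>}. range (\<lambda>l::nat. g / (c * (real l + g))))"

text \<open>Breakpoints accumulate only at 0, so the lower bound \<open>a > 0\<close> leaves
  finitely many \<open>l\<close>.\<close>

lemma finite_breakpoints:
  assumes "0 < a" "0 < \<epsilon>" "\<epsilon> < 1" "0 < g"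
  shows "finite (breakpoints g \<epsilon> \<inter> {a<..<b})"
proof -
  have "finite (range (\<lambda>l::nat. g / (c * (real l + g))) \<inter> {a<..<b})" if "c > 0" for c
  proof (rule finite_subset)
    show "range (\<lambda>l::nat. g / (c * (real l + g))) \<inter> {a<..<b}
        \<subseteq> (\<lambda>l::nat. g / (c * (real l + g))) ` {l. real l \<le> g / (a * c)}"
    proof safe
      fix l :: nat assume *: "g / (c * (real l + g)) \<in> {a<..<b}"
      have "0 < c * (real l + g)" using that assms by simp
      then have "a * (c * (real l + g)) < g" using * by (simp add: pos_less_divide_eq)
      then have "real l + g < g / (a * c)"
        using assms that by (simp add: pos_less_divide_eq mult_ac)
      then show "g / (c * (real l + g)) \<in> (\<lambda>l::nat. g / (c * (real l + g))) ` {l. real l \<le> g / (a * c)}"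
        using assms by auto
    qed
    have "finite {l. real l \<le> g / (a * c)}"
      by (rule finite_nat_set_iff_bounded_le[THEN iffD2]) (metis mem_Collect_eq le_nat_floor)
    then show "finite ((\<lambda>l::nat. g / (c * (real l + g))) ` {l. real l \<le> g / (a * c)})" by simp
  qed
  then show ?thesis using assms by (auto simp: breakpoints_def Int_Un_distrib2)
qed

text \<open>As the defining inequalities are strict, a hit can be lost but not gained on arriving at
  a breakpoint.\<close>
lemma hit_set_subset:
  assumes "0 < x" "0 < p" "0 < \<epsilon>" "\<epsilon> < 1" "0 < g"
    and nb: "\<And>r. r \<in> breakpoints g \<epsilon> \<Longrightarrow> min x p < r \<Longrightarrow> r < max x p \<Longrightarrow> False"
    and "p \<notin> breakpoints g \<epsilon>"
  shows "hit_set g \<epsilon> x \<subseteq> hit_set g \<epsilon> p"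
proof
  fix l assume "l \<in> hit_set g \<epsilon> x"
  then have l: "(1 - \<epsilon>) * x * (real l + g) < g" "g < (1 + \<epsilon>) * x * (real l + g)"
    by (auto simp: hit_set_def)
  have pos: "0 < real l + g" using assms by simp
  \<comment> \<open>The condition with factor \<open>c\<close> switches exactly when the parameter
    crosses \<open>r c\<close>.\<close>
  define r where "r c = g / (c * (real l + g))" for c
  have r: "r c \<in> breakpoints g \<epsilon>" if "c \<in> {1 - \<epsilon>, 1 + \<epsilon>}" for c
    using that by (auto simp: breakpoints_def r_def)
  have less: "c * y * (real l + g) < g \<longleftrightarrow> y < r c" "g < c * y * (real l + g) \<longleftrightarrow> r c < y"
    if "c \<in> {1 - \<epsilon>, 1 + \<epsilon>}" for c y
  proof -
    have "c * (real l + g) > 0" using that pos assms by auto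
    then show "c * y * (real l + g) < g \<longleftrightarrow> y < r c" "g < c * y * (real l + g) \<longleftrightarrow> r c < y"
      by (simp_all add: r_def pos_less_divide_eq pos_divide_less_eq mult_ac)
  qed
  have ne: "r c \<noteq> p" if "c \<in> {1 - \<epsilon>, 1 + \<epsilon>}" for c
    using r[OF that] assms by auto
  have "x < r (1 - \<epsilon>)" "r (1 + \<epsilon>) < x" using l less by auto
  \<comment> \<open>Otherwise \<open>r (1 - \<epsilon>)\<close> would be a breakpoint equal to
    \<open>p\<close> or strictly between \<open>x\<close> and \<open>p\<close>.\<close>
  have "p < r (1 - \<epsilon>)"
    using nb[OF r, of "1 - \<epsilon>"] ne[of "1 - \<epsilon>"] \<open>x < r (1 - \<epsilon>)\<close>
    by (cases "r (1 - \<epsilon>)" p rule: linorder_cases) auto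
  moreover have "r (1 + \<epsilon>) < p"
    using nb[OF r, of "1 + \<epsilon>"] ne[of "1 + \<epsilon>"] \<open>r (1 + \<epsilon>) < x\<close>
    by (cases "r (1 + \<epsilon>)" p rule: linorder_cases) auto
  ultimately show "l \<in> hit_set g \<epsilon> p" using less by (auto simp: hit_set_def)
qed

text \<open>Since \<open>F\<close> may jump at breakpoints, compactness alone does not yield a
  minimum. Instead each \<open>p\<close> is compared with its neighbours in the finite candidate set
  \<open>K\<close>, so a minimizer over \<open>K\<close> is one over the whole interval.\<close>

lemma coverage_min_at_breakpoint:
  assumes "0 < \<epsilon>" "\<epsilon> < 1" "0 < a" "a \<le> b" "b < 1" "\<gamma> \<ge> 1" "0 < g"
    and F: "\<And>p. p \<in> {a..b} \<Longrightarrow> F p = (\<Sum>l\<in>hit_set g \<epsilon> p. nb_weight \<gamma> l p)"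
  shows "\<exists>q \<in> {a, b} \<union> (breakpoints g \<epsilon> \<inter> {a<..<b}). is_arg_min F (\<lambda>p. p \<in> {a..b}) q"
proof -
  define K where "K = {a, b} \<union> (breakpoints g \<epsilon> \<inter> {a<..<b})"
  have finK: "finite K" and neK: "K \<noteq> {}" and subK: "K \<subseteq> {a..b}"
    using finite_breakpoints assms by (auto simp: K_def)
  have "\<exists>k\<in>K. F k \<le> F p" if p: "p \<in> {a..b}" for p
  proof (cases "p \<in> K")
    case True
    then show ?thesis by auto
  next
    case False
    with p have ab: "a < p" "p < b" "p \<notin> breakpoints g \<epsilon>" by (auto simp: K_def)
    \<comment> \<open>\<open>u\<close> and \<open>v\<close> are the candidates next to
      \<open>p\<close> on either side, so no breakpoint lies strictly between them.\<close>
    define u where "u = Max {k\<in>K. k < p}"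
    define v where "v = Min {k\<in>K. p < k}"
    have "a \<in> K" "b \<in> K" by (auto simp: K_def)
    have "u \<in> {k\<in>K. k < p}" unfolding u_def
      using finK ab \<open>a \<in> K\<close> by (intro Max_in) auto
    then have u: "u \<in> K" "u < p" by auto
    have "v \<in> {k\<in>K. p < k}" unfolding v_def
      using finK ab \<open>b \<in> K\<close> by (intro Min_in) auto
    then have v: "v \<in> K" "p < v" by auto
    have u_max: "k \<le> u" if "k \<in> K" "k < p" for k
      unfolding u_def using that finK by (intro Max_ge) auto
    have v_min: "v \<le> k" if "k \<in> K" "p < k" for k
      unfolding v_def using that finK by (intro Min_le) auto
    have uv: "a \<le> u" "v \<le> b" using u v subK by auto
    have no: False if "r \<in> breakpoints g \<epsilon>" "u < r" "r < v" for r
    proof -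
      have "r \<in> K" using that uv by (auto simp: K_def)
      then show False using u_max[of r] v_min[of r] that ab by (cases r p rule: linorder_cases) auto
    qed
    have sub: "hit_set g \<epsilon> u \<subseteq> hit_set g \<epsilon> p" "hit_set g \<epsilon> v \<subseteq> hit_set g \<epsilon> p"
      using assms uv u v ab by (intro hit_set_subset; auto intro: no)+
    obtain m n where mn: "hit_set g \<epsilon> p = {m..<n}"
      using hit_set_interval assms ab by (metis less_trans)
    \<comment> \<open>The hits at \<open>k\<close> are among those at \<open>p\<close>, and the
      additional weights are nonnegative.\<close>
    have le: "F k \<le> (\<Sum>l=m..<n. nb_weight \<gamma> l k)" if "k \<in> K" "hit_set g \<epsilon> k \<subseteq> hit_set g \<epsilon> p" for k
    proof -
      have k: "k \<in> {a..b}" using that subK by auto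
      then show ?thesis unfolding F[OF k] using that(2) assms
        by (auto simp: mn intro!: sum_mono2 nb_weight_nonneg)
    qed
    have "min (F u) (F v) \<le> min (\<Sum>l=m..<n. nb_weight \<gamma> l u) (\<Sum>l=m..<n. nb_weight \<gamma> l v)"
      using le[OF u(1) sub(1)] le[OF v(1) sub(2)] by (rule min.mono)
    also have "\<dots> \<le> (\<Sum>l=m..<n. nb_weight \<gamma> l p)"
      using assms u v uv by (intro sum_nb_weight_ge_min) auto
    also have "\<dots> = F p" using F[OF p] mn by simp
    finally show ?thesis using u(1) v(1) by (auto simp: min_def split: if_splits)
  qed
  moreover obtain q where "q \<in> K" "\<And>k. k \<in> K \<Longrightarrow> F q \<le> F k"
    using ex_is_arg_min_if_finite[OF finK neK, of F] by (auto simp: is_arg_min_linorder)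
  ultimately have "is_arg_min F (\<lambda>p. p \<in> {a..b}) q"
    using subK by (fastforce simp: is_arg_min_linorder)
  then show ?thesis using \<open>q \<in> K\<close> by (auto simp: K_def)
qed

subsection \<open>The stopping index of Bernoulli trials\<close>

text \<open>For fixed \<open>j\<close> the coefficient grows at most like \<open>n ^ j\<close>,
  while \<open>(1 - p) ^ n\<close> decays geometrically.\<close>

lemma binomial_term_tendsto_0:
  fixes p :: real
  assumes "0 < p" "p < 1"
  shows "(\<lambda>n. real (n choose j) * p ^ j * (1 - p) ^ (n - j)) \<longlonglongrightarrow> 0"
proof (rule tendsto_sandwich[OF _ _ tendsto_const])
  show "\<forall>\<^sub>F n in sequentially. 0 \<le> real (n choose j) * p ^ j * (1 - p) ^ (n - j)"
    using assms by simp
  show "\<forall>\<^sub>F n in sequentially. real (n choose j) * p ^ j * (1 - p) ^ (n - j)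
      \<le> (p / (1 - p)) ^ j * (real n ^ j * (1 - p) ^ n)"
  proof (rule eventually_sequentiallyI[of j])
    fix n assume "j \<le> n"
    have "real (n choose j) \<le> real n ^ j"
      using binomial_le_pow[OF \<open>j \<le> n\<close>] by (metis of_nat_le_iff of_nat_power)
    then have "real (n choose j) * (p ^ j * (1 - p) ^ (n - j)) \<le> real n ^ j * (p ^ j * (1 - p) ^ (n - j))"
      using assms by (intro mult_right_mono) auto
    also have "\<dots> = (p / (1 - p)) ^ j * (real n ^ j * (1 - p) ^ n)"
      using assms \<open>j \<le> n\<close> by (simp add: power_diff power_divide field_simps)
    finally show "real (n choose j) * p ^ j * (1 - p) ^ (n - j)
      \<le> (p / (1 - p)) ^ j * (real n ^ j * (1 - p) ^ n)" by (simp add: mult.assoc)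
  qed
  show "(\<lambda>n. (p / (1 - p)) ^ j * (real n ^ j * (1 - p) ^ n)) \<longlonglongrightarrow> 0"
    using assms by real_asymp
qed

section \<open>Partial sums of Bernoulli trials for a fixed parameter\<close>

locale bernoulli_trials = prob_space M
  for M :: "'a measure" +
  fixes X :: "nat \<Rightarrow> 'a \<Rightarrow> real" and p :: real
  assumes iid: "iid_bernoulli M X p" and p: "0 < p" "p < 1"
begin

lemma X_measurable: "i \<ge> 1 \<Longrightarrow> X i \<in> borel_measurable M"
  using iid by (auto simp: iid_bernoulli_def indep_vars_def)

lemma S_measurable [measurable]: "(\<lambda>\<omega>. \<Sum>i=1..n. X i \<omega>) \<in> borel_measurable M"
  by (intro borel_measurable_sum X_measurable) simp

text \<open>Simplification writes the lower summation bound as \<open>Suc 0\<close>, so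
  measurability is declared in that form as well.\<close>

lemmas S_measurable' [measurable] = S_measurable[simplified]

lemma prob_X:
  assumes "i \<ge> 1"
  shows "\<P>(\<omega> in M. X i \<omega> = 1) = p" "\<P>(\<omega> in M. X i \<omega> = 0) = 1 - p"
  using iid assms by (auto simp: iid_bernoulli_def)

text \<open>The disjoint events for 0 and 1 have probabilities adding up to
  \<open>(1 - p) + p = 1\<close>.\<close>

lemma AE_zero_one: "AE \<omega> in M. \<forall>i\<ge>1. X i \<omega> = 0 \<or> X i \<omega> = 1"
proof -
  have "AE \<omega> in M. i \<ge> 1 \<longrightarrow> X i \<omega> = 0 \<or> X i \<omega> = 1" for i
  proof (cases "i \<ge> 1")
    case True
    note [measurable] = X_measurable[OF True]
    have "\<P>(\<omega> in M. X i \<omega> = 0 \<or> X i \<omega> = 1) = \<P>(\<omega> in M. X i \<omega> = 0) + \<P>(\<omega> in M. X i \<omega> = 1)"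
      by (subst finite_measure_Union[symmetric]) (auto intro!: arg_cong[where f=prob])
    also have "\<dots> = 1" using prob_X[OF True] by simp
    finally have "AE \<omega> in M. X i \<omega> = 0 \<or> X i \<omega> = 1" by (subst (asm) prob_Collect_eq_1) auto
    then show ?thesis by simp
  qed simp
  then show ?thesis by (simp add: AE_all_countable)
qed

lemma prob_sum_and_next:
  "\<P>(\<omega> in M. (\<Sum>i=1..n. X i \<omega>) = s \<and> X (Suc n) \<omega> = t)
    = \<P>(\<omega> in M. (\<Sum>i=1..n. X i \<omega>) = s) * \<P>(\<omega> in M. X (Suc n) \<omega> = t)"
proof -
  have "indep_vars (\<lambda>_. borel) X (insert (Suc n) {1..n})"
    using iid by (auto simp: iid_bernoulli_def intro: indep_vars_subset)
  then have "indep_var borel (X (Suc n)) borel (\<lambda>\<omega>. \<Sum>i=1..n. X i \<omega>)"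
    by (intro indep_vars_sum) auto
  from indep_varD[OF this, of "{t}" "{s}"] show ?thesis
    by (simp add: vimage_def Int_def conj_commute mult.commute)
qed

text \<open>Splitting on the last trial gives Pascal's rule; the split holds almost surely, as other
  values have probability 0.\<close>

lemma prob_sum_eq:
  "\<P>(\<omega> in M. (\<Sum>i=1..n. X i \<omega>) = real j) = real (n choose j) * p ^ j * (1 - p) ^ (n - j)"
proof (induction n arbitrary: j)
  case 0
  then show ?case by (cases j) (auto simp: prob_space)
next
  case (Suc n)
  note [measurable] = X_measurable[of "Suc n", simplified]
  have "\<P>(\<omega> in M. (\<Sum>i=1..Suc n. X i \<omega>) = real j)
    = \<P>(\<omega> in M. ((\<Sum>i=1..n. X i \<omega>) = real j \<and> X (Suc n) \<omega> = 0)
        \<or> ((\<Sum>i=1..n. X i \<omega>) = real j - 1 \<and> X (Suc n) \<omega> = 1))"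
    by (rule measure_eq_AE) (use AE_zero_one in \<open>auto elim!: eventually_mono dest!: spec[of _ "Suc n"]\<close>)
  also have "\<dots> = \<P>(\<omega> in M. (\<Sum>i=1..n. X i \<omega>) = real j \<and> X (Suc n) \<omega> = 0)
      + \<P>(\<omega> in M. (\<Sum>i=1..n. X i \<omega>) = real j - 1 \<and> X (Suc n) \<omega> = 1)"
    by (subst finite_measure_Union[symmetric]) (auto intro!: arg_cong[where f=prob])
  also have "\<dots> = \<P>(\<omega> in M. (\<Sum>i=1..n. X i \<omega>) = real j) * (1 - p)
      + \<P>(\<omega> in M. (\<Sum>i=1..n. X i \<omega>) = real j - 1) * p"
    by (simp only: prob_sum_and_next prob_X[of "Suc n", simplified])
  also have "\<dots> = real (Suc n choose j) * p ^ j * (1 - p) ^ (Suc n - j)"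
  proof (cases j)
    case 0
    \<comment> \<open>Here \<open>real j - 1\<close> is -1, a value that a sum of zeros and ones
      cannot take.\<close>
    have "AE \<omega> in M. \<not> (\<Sum>i=1..n. X i \<omega>) = real j - 1"
      using AE_zero_one
    proof eventually_elim
      case (elim \<omega>)
      then have "(\<Sum>i=1..n. X i \<omega>) \<ge> 0" by (intro sum_nonneg) force
      then show ?case using 0 by simp
    qed
    then have "\<P>(\<omega> in M. (\<Sum>i=1..n. X i \<omega>) = real j - 1) = 0"
      by (subst prob_Collect_eq_0) auto
    then show ?thesis using Suc.IH[of 0] 0 by simp
  next
    case (Suc i)
    then have "real j - 1 = real i" by simp
    show ?thesis
    \<comment> \<open>Only for \<open>i < n\<close> does the exponent \<open>n - i\<close> exceed
      \<open>n - Suc i\<close> by one. For \<open>i \<ge> n\<close> the coefficient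
      \<open>n choose Suc i\<close> is zero.\<close>
    proof (cases "i < n")
      case True
      then have "n - i = Suc (n - Suc i)" by simp
      then have pw: "(1 - p) ^ (n - i) = (1 - p) * (1 - p) ^ (n - Suc i)" by simp
      show ?thesis unfolding \<open>real j - 1 = real i\<close> Suc.IH
        by (simp add: Suc pw algebra_simps)
    next
      case False
      then show ?thesis unfolding \<open>real j - 1 = real i\<close> Suc.IH
        by (cases "i = n") (simp_all add: Suc binomial_eq_0)
    qed
  qed
  finally show ?case .
qed

lemma AE_sum_nat: "AE \<omega> in M. \<forall>n. \<exists>j\<le>n. (\<Sum>i=1..n. X i \<omega>) = real j"
  using AE_zero_one
proof eventually_elim
  case (elim \<omega>)
  have "\<exists>j\<le>n. (\<Sum>i=1..n. X i \<omega>) = real j" for n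
  proof (induction n)
    case (Suc n)
    then obtain j where "j \<le> n" "(\<Sum>i=1..n. X i \<omega>) = real j" by auto
    moreover have "X (Suc n) \<omega> = 0 \<or> X (Suc n) \<omega> = 1" using elim by simp
    ultimately show ?case
      by (auto intro: exI[of _ j] exI[of _ "Suc j"])
  qed simp
  then show ?case by blast
qed

text \<open>A path with steps 0 and 1 that never takes the value \<open>k\<close> stays below \<open>k\<close>.\<close>
lemma AE_hits: "AE \<omega> in M. \<exists>n. (\<Sum>i=1..n. X i \<omega>) = real k"
proof -
  define N where "N = {\<omega>\<in>space M. \<forall>n. (\<Sum>i=1..n. X i \<omega>) \<noteq> real k}"
  have [measurable]: "N \<in> events" unfolding N_def by measurable
  have below: "AE \<omega> in M. \<omega> \<in> N \<longrightarrow> (\<forall>n. \<exists>j<k. (\<Sum>i=1..n. X i \<omega>) = real j)"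
    using AE_zero_one
  proof eventually_elim
    case (elim \<omega>)
    show ?case
    proof
      assume N: "\<omega> \<in> N"
      have "\<exists>j<k. (\<Sum>i=1..n. X i \<omega>) = real j" for n
      proof (induction n)
        case 0
        then show ?case using N by (auto simp: N_def dest: spec[of _ 0] intro!: exI[of _ 0] gr0I)
      next
        case (Suc n)
        then obtain j where j: "j < k" "(\<Sum>i=1..n. X i \<omega>) = real j" by auto
        have "X (Suc n) \<omega> = 0 \<or> X (Suc n) \<omega> = 1" using elim by simp
        moreover have "(\<Sum>i=1..Suc n. X i \<omega>) \<noteq> real k" using N by (simp add: N_def del: sum.cl_ivl_Suc)
        ultimately show ?case using j
          by (cases "Suc j = k") (auto intro: exI[of _ j] exI[of _ "Suc j"])
      qed
      then show "\<forall>n. \<exists>j<k. (\<Sum>i=1..n. X i \<omega>) = real j" by blast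
    qed
  qed
  \<comment> \<open>On \<open>N\<close> the sum of the first \<open>n\<close> trials is almost
    surely below \<open>k\<close>. The bound holds for every \<open>n\<close>, and its right-hand
    side tends to 0.\<close>
  have bound: "prob N \<le> (\<Sum>j<k. real (n choose j) * p ^ j * (1 - p) ^ (n - j))" for n
  proof -
    have "prob N \<le> prob (\<Union>j<k. {\<omega>\<in>space M. (\<Sum>i=1..n. X i \<omega>) = real j})"
    proof (rule finite_measure_mono_AE)
      show "AE \<omega> in M. \<omega> \<in> N \<longrightarrow> \<omega> \<in> (\<Union>j<k. {\<omega>\<in>space M. (\<Sum>i=1..n. X i \<omega>) = real j})"
        using below by eventually_elim (auto simp: N_def)
    qed measurable
    also have "\<dots> \<le> (\<Sum>j<k. prob {\<omega>\<in>space M. (\<Sum>i=1..n. X i \<omega>) = real j})"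
      by (rule finite_measure_subadditive_finite) auto
    finally show ?thesis by (simp only: prob_sum_eq)
  qed
  have "(\<lambda>n. \<Sum>j<k. real (n choose j) * p ^ j * (1 - p) ^ (n - j)) \<longlonglongrightarrow> (\<Sum>j<k. 0)"
    by (intro tendsto_sum binomial_term_tendsto_0 p)
  then have "prob N \<le> 0" using bound by (intro LIMSEQ_le_const[where X="\<lambda>n. \<Sum>j<k. real (n choose j) * p ^ j * (1 - p) ^ (n - j)"]) auto
  then have "prob N = 0" by (simp add: measure_le_0_iff)
  then have "AE \<omega> in M. \<omega> \<notin> N" by (subst (asm) prob_eq_0) auto
  then show ?thesis using AE_space by eventually_elim (auto simp: N_def)
qed

section \<open>Law of the stopping index\<close>

lemma stopping_index_measurable [measurable]: "stopping_index \<gamma> X \<in> measurable M (count_space UNIV)"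
  unfolding stopping_index_def by measurable

text \<open>Almost surely \<open>\<gamma>\<close> is reached, and \<open>n\<close> trials sum to at
  most \<open>n\<close>.\<close>

lemma AE_stopping_index_ge: "AE \<omega> in M. \<gamma> \<le> stopping_index \<gamma> X \<omega>"
  using AE_hits[of \<gamma>] AE_sum_nat
proof eventually_elim
  case (elim \<omega>)
  have "(\<Sum>i=1..stopping_index \<gamma> X \<omega>. X i \<omega>) = real \<gamma>"
    unfolding stopping_index_def using elim(1) by (rule LeastI_ex)
  then show ?case using elim(2) by (metis of_nat_eq_iff)
qed

text \<open>Stopping at \<open>l + \<gamma>\<close> means that the preceding trials contain exactly
  \<open>\<gamma> - 1\<close> successes and the next trial is a success; independence then gives a
  product.\<close>

lemma prob_stopping_index:
  assumes "\<gamma> \<ge> 1"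
  shows "\<P>(\<omega> in M. stopping_index \<gamma> X \<omega> = l + \<gamma>) = nb_weight \<gamma> l p"
proof -
  obtain g where g: "\<gamma> = Suc g" using assms by (cases \<gamma>) auto
  let ?n = "l + g"
  note [measurable] = X_measurable[of "Suc ?n", simplified]
  have "\<P>(\<omega> in M. stopping_index \<gamma> X \<omega> = l + \<gamma>)
    = \<P>(\<omega> in M. (\<Sum>i=1..?n. X i \<omega>) = real g \<and> X (Suc ?n) \<omega> = 1)"
  proof (rule measure_eq_AE)
    show "AE \<omega> in M. (\<omega> \<in> {\<omega>\<in>space M. stopping_index \<gamma> X \<omega> = l + \<gamma>})
      \<longleftrightarrow> (\<omega> \<in> {\<omega>\<in>space M. (\<Sum>i=1..?n. X i \<omega>) = real g \<and> X (Suc ?n) \<omega> = 1})"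
      using AE_zero_one AE_sum_nat AE_hits[of \<gamma>]
    proof eventually_elim
      case (elim \<omega>)
      define S where "S n = (\<Sum>i=1..n. X i \<omega>)" for n
      have step: "S (Suc n) = S n + X (Suc n) \<omega>" for n by (simp add: S_def)
      have mono: "incseq S"
        proof (rule incseq_SucI)
        show "S n \<le> S (Suc n)" for n
          using elim(1)[rule_format, of "Suc n"] by (auto simp: step)
      qed
      have stop: "stopping_index \<gamma> X \<omega> = (LEAST n. S n = real \<gamma>)" by (simp add: stopping_index_def S_def)
      have "(LEAST n. S n = real \<gamma>) = Suc ?n \<longleftrightarrow> S ?n = real g \<and> X (Suc ?n) \<omega> = 1"
      proof
        assume L: "(LEAST n. S n = real \<gamma>) = Suc ?n"
        have "S (Suc ?n) = real \<gamma>" using LeastI_ex[OF elim(3)] L by (simp add: S_def)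
        moreover have "S ?n \<noteq> real \<gamma>" using not_less_Least[of ?n "\<lambda>n. S n = real \<gamma>"] L by simp
        moreover have "X (Suc ?n) \<omega> = 0 \<or> X (Suc ?n) \<omega> = 1" using elim(1) by simp
        ultimately show "S ?n = real g \<and> X (Suc ?n) \<omega> = 1" by (auto simp: step g)
      next
        assume R: "S ?n = real g \<and> X (Suc ?n) \<omega> = 1"
        show "(LEAST n. S n = real \<gamma>) = Suc ?n"
        proof (rule Least_equality)
          show "S (Suc ?n) = real \<gamma>" using R by (simp add: step g)
          fix m assume "S m = real \<gamma>"
          \<comment> \<open>The partial sums are monotone, so up to \<open>?n\<close> they are at
            most \<open>g < \<gamma>\<close>.\<close>
          then show "Suc ?n \<le> m" using R incseqD[OF mono, of m ?n] by (force simp: g not_less_eq_eq)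
        qed
      qed
      with stop show ?case by (simp add: g S_def)
    qed
  qed measurable
  also have "\<dots> = nb_weight \<gamma> l p"
    unfolding prob_sum_and_next prob_sum_eq
    using prob_X(1)[of "Suc ?n"] by (simp add: nb_weight_def g binomial_symmetric[of g ?n])
  finally show ?thesis .
qed

text \<open>\<open>Q\<close> is constrained only at arguments from \<open>\<gamma>\<close> on, which
  suffices because the stopping index is almost surely at least \<open>\<gamma>\<close>.\<close>

lemma prob_stopping_index_in:
  assumes "\<gamma> \<ge> 1" "finite T" and Q: "\<And>l. Q (l + \<gamma>) \<longleftrightarrow> l \<in> T"
  shows "\<P>(\<omega> in M. Q (stopping_index \<gamma> X \<omega>)) = (\<Sum>l\<in>T. nb_weight \<gamma> l p)"
proof -
  have "\<P>(\<omega> in M. Q (stopping_index \<gamma> X \<omega>)) = prob (\<Union>l\<in>T. {\<omega>\<in>space M. stopping_index \<gamma> X \<omega> = l + \<gamma>})"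
  proof (rule measure_eq_AE)
    show "AE \<omega> in M. (\<omega> \<in> {\<omega>\<in>space M. Q (stopping_index \<gamma> X \<omega>)})
      \<longleftrightarrow> (\<omega> \<in> (\<Union>l\<in>T. {\<omega>\<in>space M. stopping_index \<gamma> X \<omega> = l + \<gamma>}))"
      using AE_stopping_index_ge[of \<gamma>]
    proof eventually_elim
      case (elim \<omega>)
      then obtain l where "stopping_index \<gamma> X \<omega> = l + \<gamma>" by (metis add.commute le_Suc_ex)
      then show ?case using Q by auto
    qed
  qed (use \<open>finite T\<close> in measurable)
  also have "\<dots> = (\<Sum>l\<in>T. prob {\<omega>\<in>space M. stopping_index \<gamma> X \<omega> = l + \<gamma>})"
    using \<open>finite T\<close> by (intro finite_measure_finite_Union) (auto simp: disjoint_family_on_def)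
  finally show ?thesis by (simp add: prob_stopping_index[OF \<open>\<gamma> \<ge> 1\<close>])
qed

end

theorem theorem3:
  fixes M :: "real \<Rightarrow> 'a measure"
    and X :: "real \<Rightarrow> nat \<Rightarrow> 'a \<Rightarrow> real"
    and \<epsilon> a b :: real
    and \<gamma> :: nat
  assumes "0 < \<epsilon>" and "\<epsilon> < 1"
    and "0 < a" and "a \<le> b" and "b < 1"
    and "\<gamma> \<ge> 1"
    and "\<And>p. 0 < p \<Longrightarrow> p < 1 \<Longrightarrow> iid_bernoulli (M p) (X p) p"
  shows
    "(\<gamma> \<ge> 2 \<longrightarrow>
       (\<exists>q \<in> {a, b}
          \<union> {x \<in> {a<..<b}. \<exists>l::nat. x = (real \<gamma> - 1) / ((1 - \<epsilon>) * (real l + real \<gamma> - 1))}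
          \<union> {x \<in> {a<..<b}. \<exists>l::nat. x = (real \<gamma> - 1) / ((1 + \<epsilon>) * (real l + real \<gamma> - 1))}.
          is_arg_min (\<lambda>p. \<P>(\<omega> in M p. \<bar>(p_hat \<gamma> (X p) \<omega> - p) / p\<bar> < \<epsilon>)) (\<lambda>p. p \<in> {a..b}) q))
     \<and>
       (\<exists>q \<in> {a, b}
          \<union> {x \<in> {a<..<b}. \<exists>l::nat. x = real \<gamma> / ((1 - \<epsilon>) * (real l + real \<gamma>))}
          \<union> {x \<in> {a<..<b}. \<exists>l::nat. x = real \<gamma> / ((1 + \<epsilon>) * (real l + real \<gamma>))}.
          is_arg_min (\<lambda>p. \<P>(\<omega> in M p. \<bar>(p_tilde \<gamma> (X p) \<omega> - p) / p\<bar> < \<epsilon>)) (\<lambda>p. p \<in> {a..b}) q)"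
proof -
  have candidates: "{a, b} \<union> {x \<in> {a<..<b}. \<exists>l::nat. x = g / ((1 - \<epsilon>) * (real l + g))}
      \<union> {x \<in> {a<..<b}. \<exists>l::nat. x = g / ((1 + \<epsilon>) * (real l + g))}
      = {a, b} \<union> (breakpoints g \<epsilon> \<inter> {a<..<b})" for g
    by (auto simp: breakpoints_def)
  \<comment> \<open>Both estimators are functions \<open>est\<close> of the stopping index, so one
    argument with \<open>g\<close> as parameter covers them.\<close>
  have main: "\<exists>q \<in> {a, b} \<union> (breakpoints g \<epsilon> \<inter> {a<..<b}).
      is_arg_min (\<lambda>p. \<P>(\<omega> in M p. \<bar>(est (stopping_index \<gamma> (X p) \<omega>) - p) / p\<bar> < \<epsilon>)) (\<lambda>p. p \<in> {a..b}) q"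
    if g: "0 < g" and est: "\<And>l. est (l + \<gamma>) = g / (real l + g)" for g and est :: "nat \<Rightarrow> real"
  proof (rule coverage_min_at_breakpoint[OF assms(1-6) g])
    fix p assume "p \<in> {a..b}"
    then have p: "0 < p" "p < 1" using assms by auto
    then interpret bernoulli_trials "M p" "X p" p
      using assms(7) by (auto simp: bernoulli_trials_def bernoulli_trials_axioms_def iid_bernoulli_def)
    show "\<P>(\<omega> in M p. \<bar>(est (stopping_index \<gamma> (X p) \<omega>) - p) / p\<bar> < \<epsilon>)
        = (\<Sum>l\<in>hit_set g \<epsilon> p. nb_weight \<gamma> l p)"
      using assms(2,6) p g
      by (intro prob_stopping_index_in[where Q="\<lambda>n. \<bar>(est n - p) / p\<bar> < \<epsilon>"])
         (auto simp: est hit_set_iff intro: finite_hit_set)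
  qed
  show ?thesis
  proof (intro conjI impI)
    assume "\<gamma> \<ge> 2"
    then show "\<exists>q \<in> {a, b}
          \<union> {x \<in> {a<..<b}. \<exists>l::nat. x = (real \<gamma> - 1) / ((1 - \<epsilon>) * (real l + real \<gamma> - 1))}
          \<union> {x \<in> {a<..<b}. \<exists>l::nat. x = (real \<gamma> - 1) / ((1 + \<epsilon>) * (real l + real \<gamma> - 1))}.
          is_arg_min (\<lambda>p. \<P>(\<omega> in M p. \<bar>(p_hat \<gamma> (X p) \<omega> - p) / p\<bar> < \<epsilon>)) (\<lambda>p. p \<in> {a..b}) q"
      unfolding p_hat_def
      \<comment> \<open>\<open>\<gamma> \<ge> 2\<close> makes \<open>g = \<gamma> - 1\<close>
        positive; at index \<open>l + \<gamma>\<close> the denominator of the estimator is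
        \<open>l + g\<close>.\<close>
      using main[of "real \<gamma> - 1" "\<lambda>n. (real \<gamma> - 1) / (real n - 1)"] candidates[of "real \<gamma> - 1"]
      by (simp add: add_diff_eq)
  next
    show "\<exists>q \<in> {a, b}
          \<union> {x \<in> {a<..<b}. \<exists>l::nat. x = real \<gamma> / ((1 - \<epsilon>) * (real l + real \<gamma>))}
          \<union> {x \<in> {a<..<b}. \<exists>l::nat. x = real \<gamma> / ((1 + \<epsilon>) * (real l + real \<gamma>))}.
          is_arg_min (\<lambda>p. \<P>(\<omega> in M p. \<bar>(p_tilde \<gamma> (X p) \<omega> - p) / p\<bar> < \<epsilon>)) (\<lambda>p. p \<in> {a..b}) q"
      unfolding p_tilde_def candidates
      using assms(6) by (intro main) auto
  qed
qed

end
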